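(* Let $\Psi=(\Sigma,\mathit{ind})$ be a concurrent alphabet and let $w,u$ be step sequences over $\Psi$. Then $w\equiv^{\mathbb{S}}_\Psi u$ if and only if $\Pi_{a,b}(w)=\Pi_{a,b}(u)$ for all $(a,b)\in\mathit{dep}$.
   Context: A concurrent alphabet is $\Psi=(\Sigma,\mathit{ind})$ with $\Sigma$ finite nonempty, $\mathit{ind}\subseteq\Sigma\times\Sigma$ irreflexive and symmetric, and $\mathit{dep}=(\Sigma\times\Sigma)\setminus\mathit{ind}$ (which contains all pairs $(a,a)$). Steps over $\Psi$: nonempty $A\subseteq\Sigma$ with distinct elements pairwise in $\mathit{ind}$; step sequences are finite sequences of steps. $\equiv^{\mathbb{S}}_\Psi$ is the reflexive, symmetric, transitive closure of $uABz\sim u(A\cup B)z$ for steps $A,B$ with $A\times B\subseteq\mathit{ind}$. For $(a,b)\in\mathit{dep}$, $\Pi_{a,b}$ maps step sequences to words over $\Sigma$: $\Pi_{a,b}(Av)=a\Pi_{a,b}(v)$ if $a\in A$, $b\Pi_{a,b}(v)$ if $b\in A$, $\Pi_{a,b}(v)$ if $\{a,b\}\cap A=\emptyset$, and $\Pi_{a,b}$ of the empty sequence is $\epsilon$ (a step never contains two distinct dependent actions). *)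

theory Defs
  imports Main
begin

locale concurrent_alphabet =
  fixes \<Sigma> :: "'a set" and ind :: "('a \<times> 'a) set"
  assumes finite_alphabet: "finite \<Sigma>"
    and nonempty_alphabet: "\<Sigma> \<noteq> {}"
    and ind_subset: "ind \<subseteq> \<Sigma> \<times> \<Sigma>"
    and irrefl_ind: "irrefl ind"
    and sym_ind: "sym ind"

definition dep :: "'a set \<Rightarrow> ('a \<times> 'a) set \<Rightarrow> ('a \<times> 'a) set" where
  "dep \<Sigma> ind = (\<Sigma> \<times> \<Sigma>) - ind"

definition steps :: "'a set \<Rightarrow> ('a \<times> 'a) set \<Rightarrow> 'a set set" where
  "steps \<Sigma> ind =
     {A. A \<noteq> {} \<and> A \<subseteq> \<Sigma> \<and> (\<forall>a\<in>A. \<forall>b\<in>A. a \<noteq> b \<longrightarrow> (a, b) \<in> ind)}"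

definition step_seqs :: "'a set \<Rightarrow> ('a \<times> 'a) set \<Rightarrow> 'a set list set" where
  "step_seqs \<Sigma> ind = lists (steps \<Sigma> ind)"

inductive step_sim :: "'a set \<Rightarrow> ('a \<times> 'a) set \<Rightarrow> 'a set list \<Rightarrow> 'a set list \<Rightarrow> bool"
  for \<Sigma> :: "'a set" and ind :: "('a \<times> 'a) set" where
  "u \<in> step_seqs \<Sigma> ind \<Longrightarrow> z \<in> step_seqs \<Sigma> ind \<Longrightarrow>
   A \<in> steps \<Sigma> ind \<Longrightarrow> B \<in> steps \<Sigma> ind \<Longrightarrow> A \<times> B \<subseteq> ind \<Longrightarrow>
   step_sim \<Sigma> ind (u @ [A, B] @ z) (u @ [A \<union> B] @ z)"

text \<open>The closure is reflexive on all lists of sets, but relates a step sequence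
  only to step sequences, since \<open>step_sim\<close> does.\<close>

definition step_equiv :: "'a set \<Rightarrow> ('a \<times> 'a) set \<Rightarrow> 'a set list \<Rightarrow> 'a set list \<Rightarrow> bool" where
  "step_equiv \<Sigma> ind = equivclp (step_sim \<Sigma> ind)"

text \<open>The order of the tests is immaterial for dependent \<open>a\<close>, \<open>b\<close>, as a step never
  contains two distinct dependent actions.\<close>

fun proj :: "'a \<Rightarrow> 'a \<Rightarrow> 'a set list \<Rightarrow> 'a list" where
  "proj a b [] = []"
| "proj a b (A # v) =
     (if a \<in> A then a # proj a b v
      else if b \<in> A then b # proj a b v
      else proj a b v)"

end

theory Submission
  imports Defs
begin

text \<open>Merging two independent steps cannot affect a projection to a dependent pair, since at most
  one of the two steps meets the pair. Conversely, every step sequence can be split into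
  a sequence of singleton steps, so it suffices to treat words. If the words \<open>x # xs\<close> and \<open>ys\<close> have
  the same projections, write \<open>ys = ps @ x # qs\<close> with \<open>x\<close> not in \<open>ps\<close>. Every letter \<open>p\<close> of \<open>ps\<close>
  is independent of \<open>x\<close>, because the projection to \<open>(x, p)\<close> begins with \<open>x\<close>. Hence \<open>x\<close> can be
  commuted to the front of \<open>ys\<close> and cancelled.\<close>

abbreviation word_seq :: "'a list \<Rightarrow> 'a set list" where
  "word_seq xs \<equiv> map (\<lambda>x. {x}) xs"

lemma proj_append: "proj a b (v @ w) = proj a b v @ proj a b w"
  by (induction v) auto

lemma proj_word_seq: "proj a b (word_seq xs) = filter (\<lambda>x. x = a \<or> x = b) xs"
  by (induction xs) auto

context concurrent_alphabet
begin

abbreviation equiv_steps (infix "\<approx>" 50) where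
  "v \<approx> w \<equiv> step_equiv \<Sigma> ind v w"

lemma equiv_steps_refl: "w \<approx> w"
  by (simp add: step_equiv_def)

lemma equiv_steps_sym: "v \<approx> w \<Longrightarrow> w \<approx> v"
  unfolding step_equiv_def by (rule equivclp_sym)

lemma equiv_steps_trans [trans]: "u \<approx> v \<Longrightarrow> v \<approx> w \<Longrightarrow> u \<approx> w"
  unfolding step_equiv_def by (rule equivclp_trans)

lemma step_seqs_append_iff:
  "v @ w \<in> step_seqs \<Sigma> ind \<longleftrightarrow> v \<in> step_seqs \<Sigma> ind \<and> w \<in> step_seqs \<Sigma> ind"
  by (simp add: step_seqs_def)

lemma singleton_step_iff: "{a} \<in> steps \<Sigma> ind \<longleftrightarrow> a \<in> \<Sigma>"
  by (simp add: steps_def)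

lemma word_seq_in_step_seqs_iff: "word_seq xs \<in> step_seqs \<Sigma> ind \<longleftrightarrow> set xs \<subseteq> \<Sigma>"
  by (induction xs) (auto simp: step_seqs_def singleton_step_iff)

text \<open>The outer parts \<open>u\<close> and \<open>z\<close> of a merge can absorb
  \<open>p\<close> and \<open>s\<close>. This makes \<open>\<approx>\<close> compatible with
  concatenation by step sequences.\<close>

lemma step_sim_context:
  assumes "step_sim \<Sigma> ind v w" "p \<in> step_seqs \<Sigma> ind" "s \<in> step_seqs \<Sigma> ind"
  shows "step_sim \<Sigma> ind (p @ v @ s) (p @ w @ s)"
  using assms(1)
proof cases
  case (1 u z A B)
  then show ?thesis
    using step_sim.intros[of "p @ u" \<Sigma> ind "z @ s" A B] assms(2,3)
    by (simp add: step_seqs_append_iff)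
qed

lemma equiv_steps_context:
  assumes "v \<approx> w" "p \<in> step_seqs \<Sigma> ind" "s \<in> step_seqs \<Sigma> ind"
  shows "p @ v @ s \<approx> p @ w @ s"
  using assms(1) unfolding step_equiv_def
proof (induction rule: equivclp_induct)
  case base
  show ?case by simp
next
  case (step y z)
  then show ?case
    using step_sim_context[OF _ assms(2,3)]
    by (metis equivclp_into_equivclp)
qed

lemma equiv_steps_merge:
  assumes "A \<in> steps \<Sigma> ind" "B \<in> steps \<Sigma> ind" "A \<times> B \<subseteq> ind"
  shows "[A, B] \<approx> [A \<union> B]"
  using step_sim.intros[of "[]" \<Sigma> ind "[]" A B] assms
  by (simp add: step_seqs_def step_equiv_def r_into_equivclp)

lemma proj_merge:
  assumes "(a, b) \<in> dep \<Sigma> ind" "A \<times> B \<subseteq> ind"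
  shows "proj a b [A, B] = proj a b [A \<union> B]"
proof -
  \<comment> \<open>If \<open>x\<close> in \<open>A\<close> and \<open>y\<close> in \<open>B\<close>
    both came from {a, b}, then \<open>(x, y)\<close> would be one of these four pairs and would lie
    in \<open>ind\<close>.\<close>
  have "(a, b) \<notin> ind" "(b, a) \<notin> ind" "(a, a) \<notin> ind" "(b, b) \<notin> ind"
    using assms(1) sym_ind irrefl_ind by (auto simp: dep_def sym_def irrefl_def)
  then show ?thesis using assms(2) by auto
qed

lemma proj_step_sim:
  assumes "(a, b) \<in> dep \<Sigma> ind" "step_sim \<Sigma> ind v w"
  shows "proj a b v = proj a b w"
  using assms(2)
proof cases
  case (1 u z A B)
  then show ?thesis using proj_merge[OF assms(1) 1(7)] by (simp only: proj_append)
qed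

text \<open>Besides giving the forward direction, this lets the converse replace sequences by
  equivalent words and reorder letters while the projections stay equal.\<close>

lemma proj_equiv_steps:
  assumes "(a, b) \<in> dep \<Sigma> ind" "v \<approx> w"
  shows "proj a b v = proj a b w"
  using assms(2) unfolding step_equiv_def
  by (induction rule: equivclp_induct) (use proj_step_sim[OF assms(1)] in metis)+

text \<open>A merge read backwards splits off one action at a time. The induction starts from
  singletons because the empty set is not a step.\<close>

lemma step_equiv_word:
  assumes "A \<in> steps \<Sigma> ind"
  shows "\<exists>xs. set xs \<subseteq> \<Sigma> \<and> [A] \<approx> word_seq xs"
proof -
  have "finite A" "A \<noteq> {}"
    using assms finite_alphabet by (auto simp: steps_def intro: finite_subset)
  then show ?thesis using assms
  proof (induction rule: finite_ne_induct)
    case (singleton a)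
    have "[{a}] \<approx> word_seq [a]" by (simp add: equiv_steps_refl)
    then show ?case
      using singleton.prems by (intro exI[of _ "[a]"]) (simp add: singleton_step_iff)
  next
    case (insert a F)
    \<comment> \<open>The inserted \<open>a\<close> is not in \<open>F\<close>, so pairwise
      independence within the step applies to \<open>a\<close> and each element of
      \<open>F\<close>.\<close>
    have F: "F \<in> steps \<Sigma> ind" and a: "a \<in> \<Sigma>" and ind: "{a} \<times> F \<subseteq> ind"
      using insert.prems insert.hyps by (auto simp: steps_def)
    from insert.IH[OF F] obtain xs where xs: "set xs \<subseteq> \<Sigma>" "[F] \<approx> word_seq xs" by blast
    have "[insert a F] \<approx> [{a}] @ [F] @ []"
      using equiv_steps_sym[OF equiv_steps_merge[OF _ F ind]] a by (simp add: singleton_step_iff)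
    also have "\<dots> \<approx> [{a}] @ word_seq xs @ []"
      by (rule equiv_steps_context) (use xs a in \<open>auto simp: step_seqs_def singleton_step_iff\<close>)
    finally show ?case using xs(1) a by (intro exI[of _ "a # xs"]) simp
  qed
qed

lemma step_seq_equiv_word:
  assumes "w \<in> step_seqs \<Sigma> ind"
  shows "\<exists>xs. set xs \<subseteq> \<Sigma> \<and> w \<approx> word_seq xs"
  using assms
proof (induction w)
  case Nil
  show ?case by (intro exI[of _ "[]"]) (simp add: equiv_steps_refl)
next
  case (Cons A w)
  then have A: "A \<in> steps \<Sigma> ind" and w: "w \<in> step_seqs \<Sigma> ind"
    by (auto simp: step_seqs_def)
  obtain xs where xs: "set xs \<subseteq> \<Sigma>" "[A] \<approx> word_seq xs"
    using step_equiv_word[OF A] by blast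
  obtain ys where ys: "set ys \<subseteq> \<Sigma>" "w \<approx> word_seq ys"
    using Cons.IH[OF w] by blast
  have "[] @ [A] @ w \<approx> [] @ word_seq xs @ w"
    by (rule equiv_steps_context) (use xs w in \<open>auto simp: step_seqs_def\<close>)
  also have "\<dots> = word_seq xs @ w @ []" by simp
  also have "\<dots> \<approx> word_seq xs @ word_seq ys @ []"
    by (rule equiv_steps_context)
      (use xs ys in \<open>simp_all add: word_seq_in_step_seqs_iff, simp add: step_seqs_def\<close>)
  finally show ?case using xs(1) ys(1) by (intro exI[of _ "xs @ ys"]) simp
qed

text \<open>Both orders merge into the same two-element step, since union is commutative and
  \<open>ind\<close> is symmetric.\<close>

lemma word_seq_swap:
  assumes "(a, b) \<in> ind"
  shows "[{a}, {b}] \<approx> [{b}, {a}]"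
proof -
  have ba: "(b, a) \<in> ind" using assms sym_ind by (auto dest: symD)
  have \<Sigma>: "a \<in> \<Sigma>" "b \<in> \<Sigma>" using assms ind_subset by auto
  have "[{a}, {b}] \<approx> [{a} \<union> {b}]"
    by (rule equiv_steps_merge) (use assms \<Sigma> in \<open>auto simp: singleton_step_iff\<close>)
  also have "\<dots> = [{b} \<union> {a}]" by (simp add: Un_commute)
  also have "\<dots> \<approx> [{b}, {a}]"
    by (rule equiv_steps_sym, rule equiv_steps_merge)
      (use ba \<Sigma> in \<open>auto simp: singleton_step_iff\<close>)
  finally show ?thesis .
qed

text \<open>By induction on \<open>ps\<close>, \<open>x\<close> first moves to the place right
  behind the head \<open>p\<close>; one swap then carries it past \<open>p\<close>.\<close>

lemma word_seq_move_front:
  assumes "\<And>p. p \<in> set ps \<Longrightarrow> (p, x) \<in> ind" "x \<in> \<Sigma>" "set qs \<subseteq> \<Sigma>"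
  shows "word_seq (ps @ x # qs) \<approx> word_seq (x # ps @ qs)"
  using assms(1)
proof (induction ps)
  case Nil
  show ?case by (simp add: equiv_steps_refl)
next
  case (Cons p ps)
  have px: "(p, x) \<in> ind" and ps: "set ps \<subseteq> \<Sigma>" and p: "p \<in> \<Sigma>"
    using Cons.prems ind_subset by force+
  have nil: "[] \<in> step_seqs \<Sigma> ind" by (simp add: step_seqs_def)
  have "word_seq [p] @ word_seq (ps @ x # qs) @ [] \<approx> word_seq [p] @ word_seq (x # ps @ qs) @ []"
    by (rule equiv_steps_context[OF Cons.IH _ nil])
      (use Cons.prems p in \<open>simp, simp only: word_seq_in_step_seqs_iff, simp\<close>)
  also have "\<dots> = [] @ [{p}, {x}] @ word_seq (ps @ qs)" by simp
  also have "\<dots> \<approx> [] @ [{x}, {p}] @ word_seq (ps @ qs)"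
    by (rule equiv_steps_context[OF word_seq_swap[OF px] nil])
      (use ps assms(3) in \<open>simp only: word_seq_in_step_seqs_iff, simp\<close>)
  finally show ?case by simp
qed

lemma word_seq_equiv:
  assumes "set xs \<subseteq> \<Sigma>" "set ys \<subseteq> \<Sigma>"
    and "\<And>a b. (a, b) \<in> dep \<Sigma> ind \<Longrightarrow> proj a b (word_seq xs) = proj a b (word_seq ys)"
  shows "word_seq xs \<approx> word_seq ys"
  using assms
proof (induction xs arbitrary: ys)
  case Nil
  have "ys = []"
  proof (rule ccontr)
    assume "ys \<noteq> []"
    then obtain y zs where ys: "ys = y # zs" by (cases ys) auto
    \<comment> \<open>The diagonal pair detects a single letter: the projection of \<open>ys\<close>
      to it contains \<open>y\<close>, while that of the empty word is empty.\<close>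
    then have "(y, y) \<in> dep \<Sigma> ind"
      using Nil.prems(2) irrefl_ind by (auto simp: dep_def irrefl_def)
    from Nil.prems(3)[OF this] ys show False by simp
  qed
  then show ?case by (simp add: equiv_steps_refl)
next
  case (Cons x xs)
  have x: "x \<in> \<Sigma>" and xs: "set xs \<subseteq> \<Sigma>" using Cons.prems(1) by auto
  \<comment> \<open>The projection to the diagonal pair keeps exactly the occurrences of
    \<open>x\<close>, so \<open>x\<close> must occur in \<open>ys\<close>; \<open>ps\<close> ends
    before its first occurrence.\<close>
  have "(x, x) \<in> dep \<Sigma> ind" using x irrefl_ind by (auto simp: dep_def irrefl_def)
  from Cons.prems(3)[OF this] have "x # filter (\<lambda>z. z = x) xs = filter (\<lambda>z. z = x) ys"
    by (simp add: proj_word_seq)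
  then have "x \<in> set (filter (\<lambda>z. z = x) ys)" by (metis list.set_intros(1))
  then have "x \<in> set ys" by simp
  then obtain ps qs where ys: "ys = ps @ x # qs" and x_ps: "x \<notin> set ps"
    by (meson split_list_first)
  have ps: "set ps \<subseteq> \<Sigma>" and qs: "set qs \<subseteq> \<Sigma>" using Cons.prems(2) ys by auto
  have ind: "(p, x) \<in> ind" if p: "p \<in> set ps" for p
  proof (rule ccontr)
    assume "(p, x) \<notin> ind"
    then have "(p, x) \<in> dep \<Sigma> ind" using p ps x by (auto simp: dep_def)
    from Cons.prems(3)[OF this]
    have eq: "x # filter (\<lambda>z. z = p \<or> z = x) xs
        = filter (\<lambda>z. z = p \<or> z = x) ps @ filter (\<lambda>z. z = p \<or> z = x) (x # qs)"
      unfolding proj_word_seq ys by simp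
    \<comment> \<open>Since \<open>p\<close> survives the filter, the right side of
      \<open>eq\<close> begins with a letter of \<open>ps\<close>, whereas the left side begins with
      \<open>x\<close>.\<close>
    have "p \<in> set (filter (\<lambda>z. z = p \<or> z = x) ps)" using p by simp
    then obtain r rs where r: "filter (\<lambda>z. z = p \<or> z = x) ps = r # rs"
      by (cases "filter (\<lambda>z. z = p \<or> z = x) ps") auto
    with eq have "r = x" by simp
    moreover have "r \<in> set ps" using r by (metis filter_is_subset list.set_intros(1) subsetD)
    ultimately show False using x_ps by simp
  qed
  have front: "word_seq ys \<approx> word_seq (x # ps @ qs)"
    unfolding ys by (rule word_seq_move_front) (use ind x qs in auto)
  have "word_seq xs \<approx> word_seq (ps @ qs)"
  proof (rule Cons.IH[OF xs])
    show "set (ps @ qs) \<subseteq> \<Sigma>" using ps qs by simp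
    fix a b assume ab: "(a, b) \<in> dep \<Sigma> ind"
    \<comment> \<open>Moving \<open>x\<close> to the front preserves projections. Now either both
      projections start with the letter \<open>x\<close> or both skip it, so it can be
      cancelled.\<close>
    have "proj a b (word_seq (x # xs)) = proj a b (word_seq (x # ps @ qs))"
      using Cons.prems(3)[OF ab] proj_equiv_steps[OF ab front] by simp
    then show "proj a b (word_seq xs) = proj a b (word_seq (ps @ qs))"
      by (simp split: if_splits)
  qed
  then have "word_seq [x] @ word_seq xs @ [] \<approx> word_seq [x] @ word_seq (ps @ qs) @ []"
    by (rule equiv_steps_context)
      (use x in \<open>simp only: word_seq_in_step_seqs_iff, simp, simp add: step_seqs_def\<close>)
  then have "word_seq (x # xs) \<approx> word_seq (x # ps @ qs)" by simp
  then show ?case using equiv_steps_sym[OF front] by (rule equiv_steps_trans)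
qed

lemma equiv_steps_iff_proj:
  assumes "w \<in> step_seqs \<Sigma> ind" "u \<in> step_seqs \<Sigma> ind"
  shows "w \<approx> u \<longleftrightarrow> (\<forall>(a, b) \<in> dep \<Sigma> ind. proj a b w = proj a b u)"
proof
  assume "w \<approx> u"
  then show "\<forall>(a, b) \<in> dep \<Sigma> ind. proj a b w = proj a b u"
    using proj_equiv_steps by blast
next
  assume eq: "\<forall>(a, b) \<in> dep \<Sigma> ind. proj a b w = proj a b u"
  obtain xs where xs: "set xs \<subseteq> \<Sigma>" "w \<approx> word_seq xs"
    using step_seq_equiv_word[OF assms(1)] by blast
  obtain ys where ys: "set ys \<subseteq> \<Sigma>" "u \<approx> word_seq ys"
    using step_seq_equiv_word[OF assms(2)] by blast
  have "proj a b (word_seq xs) = proj a b (word_seq ys)" if ab: "(a, b) \<in> dep \<Sigma> ind" for a b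
    using eq ab proj_equiv_steps[OF ab xs(2)] proj_equiv_steps[OF ab ys(2)] by auto
  then have "word_seq xs \<approx> word_seq ys" by (rule word_seq_equiv[OF xs(1) ys(1)])
  then show "w \<approx> u" using xs(2) ys(2) equiv_steps_sym equiv_steps_trans by blast
qed

end

theorem theorem2p7:
  fixes \<Sigma> :: "'a set" and ind :: "('a \<times> 'a) set" and w u :: "'a set list"
  assumes "concurrent_alphabet \<Sigma> ind"
    and "w \<in> step_seqs \<Sigma> ind" and "u \<in> step_seqs \<Sigma> ind"
  shows "step_equiv \<Sigma> ind w u \<longleftrightarrow> (\<forall>(a, b) \<in> dep \<Sigma> ind. proj a b w = proj a b u)"
  using concurrent_alphabet.equiv_steps_iff_proj[OF assms] .

end
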